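(* (Trapezoid inequality) Let $I\subset\mathbb{R}$ be an interval with interior $I^{\circ}$, let $a,b\in I^{\circ}$ with $a<b$, and let $f:I\to\mathbb{R}$ be twice differentiable on $I^{\circ}$ with $f,f',f''\in L[a,b]$. Let $p,q\ge 1$ be real with $\frac1p+\frac1q=1$, and suppose $|f''|^q$ is convex on $[a,b]$. Then $$\left|\frac{f(a)+f(b)}{2}-\frac1{b-a}\int_a^b f(x)\,dx\right|\le (b-a)^2\left(\frac{2^{p+1}-1}{2^{2p+1}(p+1)}\right)^{\frac1p}\left\{\left[\frac{|f''(b)|^q}{2^{q+2}(q+2)}+\beta\left(\tfrac12;q+1,2\right)|f''(a)|^q\right]^{\frac1q}+\left[\beta\left(\tfrac12;q+1,2\right)|f''(b)|^q+\frac{|f''(a)|^q}{2^{q+2}(q+2)}\right]^{\frac1q}\right\}.$$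
   Context: $L[a,b]$ denotes the Lebesgue integrable real-valued functions on $[a,b]$. $\beta$ is the (unnormalized) incomplete Beta function $\beta(x;u,v)=\int_0^x t^{u-1}(1-t)^{v-1}\,dt$ for $x\in[0,1]$, $u,v>0$. *)

theory Defs
  imports "HOL-Analysis.Analysis"
begin

(* Intended for 0 \<le> x \<le> 1 and u, v > 0. The convention 0 powr c = 0 affects the
   integrand only at t = 0 and t = 1, a null set. *)
definition incomplete_Beta :: "real \<Rightarrow> real \<Rightarrow> real \<Rightarrow> real" where
  "incomplete_Beta x u v = (LINT t:{0..x}|lebesgue. t powr (u - 1) * (1 - t) powr (v - 1))"

end

theory Submission imports Defs begin

text \<open>
  On the unit interval put \<open>g t = f (a + t (b - a))\<close>. Integrating the derivative of
  \<open>t (1 - t) / 2 * g' t - (1 - 2 t) / 2 * g t\<close> expresses the trapezoid error as the integral of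
  \<open>t (1 - t) / 2 * g'' t\<close>. Fold this integral at \<open>1/2\<close>, so that both halves live on
  \<open>[0, 1/2]\<close>, and apply Hoelder's inequality to each half with the kernel split as
  \<open>(1 - t) / 2\<close> times \<open>t\<close>. Convexity replaces \<open>\<bar>f''\<bar>\<close> by a continuous majorant, so Hoelder's
  inequality is only needed for continuous functions.
\<close>

text \<open>Divide each factor by its norm, apply Young's inequality pointwise to the quotients,
  integrate, and multiply the norms back.\<close>

lemma Holder_inequality_integral:
  fixes u v :: "real \<Rightarrow> real"
  assumes u: "continuous_on {s..t} u" "\<And>x. x \<in> {s..t} \<Longrightarrow> 0 \<le> u x"
    and v: "continuous_on {s..t} v" "\<And>x. x \<in> {s..t} \<Longrightarrow> 0 \<le> v x"
    and pq: "p > 1" "q > 1" "1 / p + 1 / q = 1"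
  shows "integral {s..t} (\<lambda>x. u x * v x) \<le>
    integral {s..t} (\<lambda>x. u x powr p) powr (1 / p) * integral {s..t} (\<lambda>x. v x powr q) powr (1 / q)"
proof (cases "s < t")
  case False
  then show ?thesis
    by (cases "s = t") auto
next
  case True
  define U where "U = integral {s..t} (\<lambda>x. u x powr p)"
  define V where "V = integral {s..t} (\<lambda>x. v x powr q)"
  have cu: "continuous_on {s..t} (\<lambda>x. u x powr p)"
    using u pq by (intro continuous_on_powr' continuous_intros) auto
  have cv: "continuous_on {s..t} (\<lambda>x. v x powr q)"
    using v pq by (intro continuous_on_powr' continuous_intros) auto
  have hU: "((\<lambda>x. u x powr p) has_integral U) {s..t}"
    unfolding U_def using cu integrable_continuous_real by blast
  have hV: "((\<lambda>x. v x powr q) has_integral V) {s..t}"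
    unfolding V_def using cv integrable_continuous_real by blast
  have "(\<lambda>x. u x * v x) integrable_on {s..t}"
    using u v by (intro integrable_continuous_real continuous_intros)
  then have hUV: "((\<lambda>x. u x * v x) has_integral integral {s..t} (\<lambda>x. u x * v x)) {s..t}"
    by blast
  have nonneg: "U \<ge> 0" "V \<ge> 0"
    using has_integral_nonneg[OF hU] has_integral_nonneg[OF hV] by auto
  show ?thesis
  \<comment> \<open>Normalisation fails if a norm vanishes. In that case a continuous nonnegative
    power with zero integral over a nondegenerate interval is identically zero, so the product
    vanishes as well.\<close>
  proof (cases "U = 0 \<or> V = 0")
    case True
    then have "(\<forall>x\<in>{s..t}. u x = 0) \<or> (\<forall>x\<in>{s..t}. v x = 0)"
      using integral_eq_0_iff[OF cu \<open>s < t\<close>] integral_eq_0_iff[OF cv \<open>s < t\<close>]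
      unfolding U_def V_def by auto
    then have "integral {s..t} (\<lambda>x. u x * v x) = integral {s..t} (\<lambda>x. 0)"
      by (intro integral_cong) auto
    then show ?thesis by simp
  next
    case False
    then have pos: "U > 0" "V > 0"
      using nonneg by auto
    define \<alpha> where "\<alpha> = U powr (1 / p)"
    define \<beta> where "\<beta> = V powr (1 / q)"
    have ab: "\<alpha> > 0" "\<beta> > 0" "\<alpha> powr p = U" "\<beta> powr q = V"
      using pos pq by (auto simp: \<alpha>_def \<beta>_def powr_powr)
    have young: "u x * v x \<le> \<alpha> * \<beta> * (u x powr p / (p * U) + v x powr q / (q * V))"
      if x: "x \<in> {s..t}" for x
    proof -
      have "(u x / \<alpha>) * (v x / \<beta>) \<le> (u x / \<alpha>) powr p / p + (v x / \<beta>) powr q / q"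
        using pq u(2)[OF x] v(2)[OF x] ab by (intro Youngs_inequality) auto
      also have "\<dots> = u x powr p / (p * U) + v x powr q / (q * V)"
        using ab u(2)[OF x] v(2)[OF x] by (simp add: powr_divide mult.commute)
      finally show ?thesis
        using ab by (simp add: field_simps)
    qed
    have "((\<lambda>x. \<alpha> * \<beta> * (u x powr p / (p * U) + v x powr q / (q * V))) has_integral
        \<alpha> * \<beta> * (U / (p * U) + V / (q * V))) {s..t}"
      by (intro has_integral_mult_right has_integral_add has_integral_divide hU hV)
    \<comment> \<open>By the choice of \<open>\<alpha>\<close> and \<open>\<beta>\<close> the
      integrals \<open>U\<close> and \<open>V\<close> cancel, and only
      \<open>1 / p + 1 / q = 1\<close> remains as a factor of
      \<open>\<alpha> * \<beta>\<close>.\<close>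
    from has_integral_le[OF hUV this young]
    have "integral {s..t} (\<lambda>x. u x * v x) \<le> \<alpha> * \<beta> * (1 / p + 1 / q)"
      using pos by simp
    then show ?thesis
      unfolding pq(3) \<alpha>_def \<beta>_def U_def V_def by simp
  qed
qed

text \<open>A bridge from the Lebesgue integral that defines \<open>incomplete_Beta\<close> to
  \<open>has_integral\<close>, by continuity of the integrand. The second parameter 2 leaves
  exponent 1 on \<open>1 - t\<close>, which is nonnegative on this interval, so its
  \<open>powr\<close> disappears.\<close>

lemma incomplete_Beta_half_has_integral:
  assumes "q > 0"
  shows "((\<lambda>t. t powr q * (1 - t)) has_integral incomplete_Beta (1/2) (q + 1) 2) {0..1/2}"
proof -
  let ?h = "\<lambda>t::real. t powr (q + 1 - 1) * (1 - t) powr (2 - 1)"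
  have cont: "continuous_on {0..1/2} ?h"
    using assms by (intro continuous_on_mult continuous_on_powr' continuous_intros) auto
  have "set_integrable lebesgue {0..1/2} ?h"
    using absolutely_integrable_continuous_real[OF cont] .
  from has_integral_set_lebesgue[OF this]
  have "(?h has_integral incomplete_Beta (1/2) (q + 1) 2) {0..1/2}"
    by (simp add: incomplete_Beta_def)
  then show ?thesis
    by (rule has_integral_eq[rotated]) auto
qed

text \<open>This evaluates the p-th power of the norm of the Hoelder factor
  \<open>(1 - t) / 2\<close>. The primitive \<open>?F\<close> takes \<open>powr (p + 1)\<close> of
  1/4 at the right end and of 1/2 at the left end.\<close>

lemma has_integral_half_one_minus_powr:
  fixes p :: real
  assumes "p \<ge> 1"
  shows "((\<lambda>t. ((1 - t) / 2) powr p) has_integral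
    (2 powr (p + 1) - 1) / (2 powr (2 * p + 1) * (p + 1))) {0..1/2}"
proof -
  let ?F = "\<lambda>t::real. - 2 / (p + 1) * ((1 - t) / 2) powr (p + 1)"
  have "((\<lambda>t. ((1 - t) / 2) powr p) has_integral ?F (1/2) - ?F 0) {0..1/2}"
  proof (rule fundamental_theorem_of_calculus)
    fix t :: real assume "t \<in> {0..1/2}"
    then have "(?F has_real_derivative ((1 - t) / 2) powr p) (at t within {0..1/2})"
      using assms by (auto intro!: derivative_eq_intros)
    then show "(?F has_vector_derivative ((1 - t) / 2) powr p) (at t within {0..1/2})"
      by (simp add: has_real_derivative_iff_has_vector_derivative)
  qed simp
  moreover have "?F (1/2) - ?F 0 = (2 powr (p + 1) - 1) / (2 powr (2 * p + 1) * (p + 1))"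
  proof -
    \<comment> \<open>All powers involved are rational expressions in \<open>P\<close>, which turns
      the claim into an identity of rational functions.\<close>
    define P :: real where "P = 2 powr p"
    have "P > 0" by (simp add: P_def)
    have quarter: "(1/4::real) powr (p + 1) = 1 / (4 * P\<^sup>2)"
    proof -
      have "(1/4::real) powr (p + 1) = (1/2 * (1/2)) powr (p + 1)" by simp
      also have "\<dots> = ((1/2) powr (p + 1))\<^sup>2"
        by (subst powr_mult) (auto simp: power2_eq_square)
      also have "(1/2::real) powr (p + 1) = 1 / (2 * P)"
        by (simp add: powr_add powr_divide P_def)
      finally show ?thesis by (simp add: power2_eq_square)
    qed
    have half: "(1/2::real) powr (p + 1) = 1 / (2 * P)"
      by (simp add: powr_add powr_divide P_def)
    have "2 powr (2 * p) = P\<^sup>2"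
      unfolding P_def power2_eq_square by (metis mult_2 powr_add)
    then have "2 powr (2 * p + 1) = 2 * P\<^sup>2" "2 powr (p + 1) = 2 * P"
      by (simp_all add: powr_add P_def)
    then show ?thesis
      using assms \<open>P > 0\<close> quarter half
      by (simp add: divide_simps power2_eq_square) (simp add: algebra_simps)
  qed
  ultimately show ?thesis by simp
qed

text \<open>Giving the whole factor \<open>t\<close> to the q-side of Hoelder's inequality produces
  the weight \<open>t powr q\<close>. Integrated against the affine bound
  \<open>t * B + (1 - t) * A\<close>, it yields an elementary power integral for \<open>B\<close>
  and the incomplete Beta value for \<open>A\<close>.\<close>

lemma half_kernel_integral_bound:
  fixes g :: "real \<Rightarrow> real"
  assumes pq: "p > 1" "q > 1" "1 / p + 1 / q = 1"
    and AB: "A \<ge> 0" "B \<ge> 0"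
    and g: "\<And>t. t \<in> {0..1/2} \<Longrightarrow> \<bar>g t\<bar> powr q \<le> t * B + (1 - t) * A"
    and J: "((\<lambda>t. t * (1 - t) / 2 * g t) has_integral J) {0..1/2}"
  shows "\<bar>J\<bar> \<le> ((2 powr (p + 1) - 1) / (2 powr (2 * p + 1) * (p + 1))) powr (1 / p) *
    (B / (2 powr (q + 2) * (q + 2)) + incomplete_Beta (1 / 2) (q + 1) 2 * A) powr (1 / q)"
proof -
  define u where "u = (\<lambda>t::real. (1 - t) / 2)"
  define m where "m = (\<lambda>t. t * B + (1 - t) * A)"
  \<comment> \<open>The q-th root of the affine majorant stands in for
    \<open>\<bar>g t\<bar>\<close>. It makes \<open>v\<close> continuous, and its root disappears
    again in \<open>v t powr q\<close>.\<close>
  define v where "v = (\<lambda>t. t * m t powr (1 / q))"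
  have m: "m t \<ge> 0" if "t \<in> {0..1/2}" for t
    using that AB by (auto simp: m_def)
  have cu: "continuous_on {0..1/2} u"
    by (auto simp: u_def intro!: continuous_intros)
  have cm: "continuous_on {0..1/2} m"
    unfolding m_def by (intro continuous_intros)
  have cv: "continuous_on {0..1/2} v"
    unfolding v_def using pq m cm by (intro continuous_on_mult continuous_on_powr' continuous_intros) auto
  have "(\<lambda>t. u t * v t) integrable_on {0..1/2}"
    by (intro integrable_continuous_real continuous_intros cu cv)
  then have uv: "((\<lambda>t. u t * v t) has_integral integral {0..1/2} (\<lambda>t. u t * v t)) {0..1/2}"
    by blast
  have le: "\<bar>t * (1 - t) / 2 * g t\<bar> \<le> u t * v t" if t: "t \<in> {0..1/2}" for t
  proof -
    have "\<bar>g t\<bar> = (\<bar>g t\<bar> powr q) powr (1 / q)"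
      using pq by (simp add: powr_powr)
    also have "\<dots> \<le> m t powr (1 / q)"
      using g[OF t] pq by (intro powr_mono2) (auto simp: m_def)
    finally have "t * (1 - t) / 2 * \<bar>g t\<bar> \<le> t * (1 - t) / 2 * m t powr (1 / q)"
      using t by (intro mult_left_mono) auto
    then show ?thesis
      using t by (simp add: u_def v_def abs_mult mult_ac)
  qed
  have vq: "((\<lambda>t. v t powr q) has_integral
    B * ((1/2) powr (q + 1 + 1) / (q + 1 + 1)) + A * incomplete_Beta (1/2) (q + 1) 2) {0..1/2}"
  proof (rule has_integral_eq)
    show "((\<lambda>t. B * t powr (q + 1) + A * (t powr q * (1 - t))) has_integral
      B * ((1/2) powr (q + 1 + 1) / (q + 1 + 1)) + A * incomplete_Beta (1/2) (q + 1) 2) {0..1/2}"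
      using pq by (intro has_integral_add has_integral_mult_right has_integral_powr_from_0
          incomplete_Beta_half_has_integral) auto
  next
    fix t :: real assume t: "t \<in> {0..1/2}"
    have "v t powr q = t powr q * m t"
      using t m[OF t] pq by (simp add: v_def powr_mult powr_powr)
    also have "\<dots> = B * t powr (q + 1) + A * (t powr q * (1 - t))"
      using t by (simp add: m_def powr_add algebra_simps)
    finally show "B * t powr (q + 1) + A * (t powr q * (1 - t)) = v t powr q" ..
  qed
  have up: "integral {0..1/2} (\<lambda>t. u t powr p)
      = (2 powr (p + 1) - 1) / (2 powr (2 * p + 1) * (p + 1))"
    unfolding u_def using pq by (intro integral_unique has_integral_half_one_minus_powr) simp
  have "integral {0..1/2} (\<lambda>t. v t powr q)
      = B * ((1/2) powr (q + 2) / (q + 2)) + A * incomplete_Beta (1/2) (q + 1) 2"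
    using integral_unique[OF vq] by (simp add: add.assoc)
  also have "\<dots> = B / (2 powr (q + 2) * (q + 2)) + incomplete_Beta (1/2) (q + 1) 2 * A"
    by (simp add: powr_divide mult.commute)
  finally have vq': "integral {0..1/2} (\<lambda>t. v t powr q)
      = B / (2 powr (q + 2) * (q + 2)) + incomplete_Beta (1/2) (q + 1) 2 * A" .
  \<comment> \<open>The pointwise bound is integrated twice, for the integrand and for its negative,
    to control \<open>J\<close> from both sides.\<close>
  have "\<bar>J\<bar> \<le> integral {0..1/2} (\<lambda>t. u t * v t)"
  proof (rule abs_leI)
    show "J \<le> integral {0..1/2} (\<lambda>t. u t * v t)"
      by (rule has_integral_le[OF J uv abs_le_D1[OF le]])
    show "- J \<le> integral {0..1/2} (\<lambda>t. u t * v t)"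
      by (rule has_integral_le[OF has_integral_neg[OF J] uv abs_le_D2[OF le]])
  qed
  also have "\<dots> \<le> integral {0..1/2} (\<lambda>t. u t powr p) powr (1 / p)
      * integral {0..1/2} (\<lambda>t. v t powr q) powr (1 / q)"
    using pq by (intro Holder_inequality_integral cu cv) (auto simp: u_def v_def)
  finally show ?thesis
    unfolding up vq' .
qed

text \<open>Two integrations by parts, packed into the single primitive \<open>?H\<close>: in its
  derivative the two terms with \<open>f'\<close> cancel.\<close>

lemma trapezoid_error_has_integral:
  fixes f f' f'' :: "real \<Rightarrow> real"
  assumes "a < b"
    and f: "\<And>x. x \<in> {a..b} \<Longrightarrow> (f has_real_derivative f' x) (at x)"
    and f': "\<And>x. x \<in> {a..b} \<Longrightarrow> (f' has_real_derivative f'' x) (at x)"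
  shows "((\<lambda>t. t * (1 - t) / 2 * f'' (a + t * (b - a))) has_integral
    ((f a + f b) / 2 - 1 / (b - a) * integral {a..b} f) / (b - a)\<^sup>2) {0..1}"
proof -
  define h where "h = b - a"
  have h: "h > 0" using assms by (simp add: h_def)
  have mem: "a + t * h \<in> {a..b}" if "t \<in> {0..1}" for t
  proof -
    have "0 \<le> t * h" "t * h \<le> 1 * h"
      using that h by (auto intro!: mult_right_mono)
    then show ?thesis by (simp add: h_def)
  qed
  \<comment> \<open>The factor \<open>h\<close> comes from the chain rule. At 0 and 1 the first
    summand vanishes, and the second one contributes half of each endpoint value of
    \<open>f\<close>.\<close>
  let ?H = "\<lambda>t. t * (1 - t) / 2 * h * f' (a + t * h) - (1 - 2 * t) / 2 * f (a + t * h)"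
  let ?k = "\<lambda>t. t * (1 - t) / 2 * f'' (a + t * h)"
  have total: "((\<lambda>t. h\<^sup>2 * ?k t + f (a + t * h)) has_integral ?H 1 - ?H 0) {0..1}"
  proof (rule fundamental_theorem_of_calculus)
    fix t :: real assume t: "t \<in> {0..1}"
    have affine: "((\<lambda>t. a + t * h) has_real_derivative h) (at t)"
      by (auto intro!: derivative_eq_intros)
    note D = DERIV_chain2[where g = "\<lambda>t. a + t * h", OF f[OF mem[OF t]] affine]
      DERIV_chain2[where g = "\<lambda>t. a + t * h", OF f'[OF mem[OF t]] affine]
    have "(?H has_real_derivative h\<^sup>2 * ?k t + f (a + t * h)) (at t)"
      by (auto intro!: derivative_eq_intros D simp: field_simps power2_eq_square)
    then show "(?H has_vector_derivative h\<^sup>2 * ?k t + f (a + t * h)) (at t within {0..1})"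
      using has_field_derivative_at_within has_real_derivative_iff_has_vector_derivative by blast
  qed simp
  have "continuous_on {a..b} f"
    using f DERIV_isCont by (intro continuous_at_imp_continuous_on) blast
  then have "(f has_integral integral {a..b} f) (cbox a b)"
    using integrable_continuous_real by auto
  \<comment> \<open>The substitution \<open>x = a + t * h\<close> maps the unit interval onto
    \<open>{a..b}\<close> and divides the integral by \<open>h\<close>.\<close>
  from has_integral_affinity'[OF this h, of a]
  have "((\<lambda>t. f (a + t * h)) has_integral integral {a..b} f / h) {0..1}"
    using h by (simp add: h_def[symmetric] field_simps)
  from has_integral_divide[OF has_integral_diff[OF total this], of "h\<^sup>2"]
  have "(?k has_integral (?H 1 - ?H 0 - integral {a..b} f / h) / h\<^sup>2) {0..1}"
    using h by simp
  moreover have "?H 1 - ?H 0 = (f a + f b) / 2"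
    by (simp add: h_def)
  ultimately show ?thesis
    by (simp only: h_def) simp
qed

text \<open>The reflection \<open>t\<close> to \<open>1 - t\<close> carries the right half of the
  unit interval onto the left half. It fixes the kernel \<open>k\<close>, so only the argument of
  \<open>g\<close> changes.\<close>

lemma symmetric_kernel_integral_fold:
  fixes k g :: "real \<Rightarrow> real"
  assumes J: "((\<lambda>t. k t * g t) has_integral J) {0..1}"
    and k: "\<And>t. k (1 - t) = k t"
  obtains J1 J2 where "((\<lambda>t. k t * g t) has_integral J1) {0..1/2}"
    and "((\<lambda>t. k t * g (1 - t)) has_integral J2) {0..1/2}" and "J = J1 + J2"
proof -
  let ?m = "\<lambda>t. k t * g t"
  have "?m integrable_on {0..1}" using J by blast
  then have I: "?m integrable_on {0..1/2}" "?m integrable_on {1/2..1}"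
    by (auto intro: integrable_on_subinterval)
  then obtain J1 J2 where J1: "(?m has_integral J1) {0..1/2}" and J2: "(?m has_integral J2) {1/2..1}"
    by blast
  have "J = J1 + J2"
    using has_integral_combine[OF _ _ J1 J2] J by (simp add: has_integral_unique)
  moreover have "((\<lambda>t. k t * g (1 - t)) has_integral J2) {0..1/2}"
    using has_integral_affinity[of ?m J2 "1/2" 1 "-1" 1] J2 k
    by (simp add: image_affinity_atLeastAtMost)
  ultimately show thesis using that J1 by blast
qed

theorem proposition2:
  fixes I :: "real set" and f f' f'' :: "real \<Rightarrow> real" and a b p q :: real
  assumes "is_interval I"
    and "a \<in> interior I" and "b \<in> interior I" and "a < b"
    and "\<And>x. x \<in> interior I \<Longrightarrow> (f has_real_derivative f' x) (at x)"
    and "\<And>x. x \<in> interior I \<Longrightarrow> (f' has_real_derivative f'' x) (at x)"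
    and "set_integrable lebesgue {a..b} f"
    and "set_integrable lebesgue {a..b} f'"
    and "set_integrable lebesgue {a..b} f''"
    and "p \<ge> 1" and "q \<ge> 1" and "1 / p + 1 / q = 1"
    and "convex_on {a..b} (\<lambda>x. \<bar>f'' x\<bar> powr q)"
  shows "\<bar>(f a + f b) / 2 - 1 / (b - a) * (LINT x:{a..b}|lebesgue. f x)\<bar>
    \<le> (b - a)\<^sup>2 * ((2 powr (p + 1) - 1) / (2 powr (2 * p + 1) * (p + 1))) powr (1 / p) *
      ((\<bar>f'' b\<bar> powr q / (2 powr (q + 2) * (q + 2))
          + incomplete_Beta (1 / 2) (q + 1) 2 * \<bar>f'' a\<bar> powr q) powr (1 / q)
       + (incomplete_Beta (1 / 2) (q + 1) 2 * \<bar>f'' b\<bar> powr q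
          + \<bar>f'' a\<bar> powr q / (2 powr (q + 2) * (q + 2))) powr (1 / q))"
proof -
  \<comment> \<open>If one exponent were 1, the reciprocal of the other would be 0, which is
    impossible for an exponent at least 1. The strict bounds are what the Hoelder estimate
    requires.\<close>
  have pq: "p > 1" "q > 1"
    using assms(10-12) by (cases "p = 1"; cases "q = 1"; simp)+
  have "convex (interior I)"
    using assms(1) by (simp add: is_interval_convex convex_interior)
  then have sub: "{a..b} \<subseteq> interior I"
    using assms(2,3) closed_segment_subset[of a "interior I" b] assms(4)
    by (simp add: closed_segment_eq_real_ivl)
  define g where "g = (\<lambda>t. f'' (a + t * (b - a)))"
  define E where "E = (f a + f b) / 2 - 1 / (b - a) * (LINT x:{a..b}|lebesgue. f x)"
  \<comment> \<open>Integrability of \<open>f\<close> identifies its Lebesgue integral with the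
    gauge integral used in the lemmas.\<close>
  have "E = (f a + f b) / 2 - 1 / (b - a) * integral {a..b} f"
    unfolding E_def using set_lebesgue_integral_eq_integral(2)[OF assms(7)] by simp
  moreover have "((\<lambda>t. t * (1 - t) / 2 * g t) has_integral
      ((f a + f b) / 2 - 1 / (b - a) * integral {a..b} f) / (b - a)\<^sup>2) {0..1}"
    unfolding g_def using sub assms(4-6) by (intro trapezoid_error_has_integral[where f' = f']) auto
  ultimately have J: "((\<lambda>t. t * (1 - t) / 2 * g t) has_integral E / (b - a)\<^sup>2) {0..1}"
    by simp
  have g: "\<bar>g t\<bar> powr q \<le> t * \<bar>f'' b\<bar> powr q + (1 - t) * \<bar>f'' a\<bar> powr q"
    if "t \<in> {0..1}" for t
  proof -
    have "a + t * (b - a) = (1 - t) *\<^sub>R a + t *\<^sub>R b"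
      by (simp add: algebra_simps)
    then show ?thesis
      using convex_onD[OF assms(13), of t a b] that assms(4) unfolding g_def by simp
  qed
  obtain J1 J2 where J1: "((\<lambda>t. t * (1 - t) / 2 * g t) has_integral J1) {0..1/2}"
    and J2: "((\<lambda>t. t * (1 - t) / 2 * g (1 - t)) has_integral J2) {0..1/2}"
    and J12: "E / (b - a)\<^sup>2 = J1 + J2"
    using symmetric_kernel_integral_fold[OF J] by (auto simp: mult.commute)
  let ?C = "((2 powr (p + 1) - 1) / (2 powr (2 * p + 1) * (p + 1))) powr (1 / p)"
  have b1: "\<bar>J1\<bar> \<le> ?C * (\<bar>f'' b\<bar> powr q / (2 powr (q + 2) * (q + 2))
      + incomplete_Beta (1 / 2) (q + 1) 2 * \<bar>f'' a\<bar> powr q) powr (1 / q)"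
    using g by (intro half_kernel_integral_bound[OF pq assms(12) _ _ _ J1]) auto
  \<comment> \<open>Replacing \<open>t\<close> by \<open>1 - t\<close> in the convexity bound
    exchanges the endpoint weights, so \<open>a\<close> and \<open>b\<close> trade roles compared
    with \<open>b1\<close>.\<close>
  have b2: "\<bar>J2\<bar> \<le> ?C * (\<bar>f'' a\<bar> powr q / (2 powr (q + 2) * (q + 2))
      + incomplete_Beta (1 / 2) (q + 1) 2 * \<bar>f'' b\<bar> powr q) powr (1 / q)"
  proof (rule half_kernel_integral_bound[OF pq assms(12) _ _ _ J2])
    show "\<bar>g (1 - t)\<bar> powr q \<le> t * \<bar>f'' a\<bar> powr q + (1 - t) * \<bar>f'' b\<bar> powr q"
      if "t \<in> {0..1/2}" for t
      using g[of "1 - t"] that by simp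
  qed auto
  have "E = (b - a)\<^sup>2 * (J1 + J2)"
    using J12 assms(4) by (simp add: field_simps)
  then have "\<bar>E\<bar> \<le> (b - a)\<^sup>2 * (\<bar>J1\<bar> + \<bar>J2\<bar>)"
    by (simp add: abs_mult mult_left_mono)
  also have "\<dots> \<le> (b - a)\<^sup>2 * (?C * (\<bar>f'' b\<bar> powr q / (2 powr (q + 2) * (q + 2))
      + incomplete_Beta (1 / 2) (q + 1) 2 * \<bar>f'' a\<bar> powr q) powr (1 / q)
    + ?C * (\<bar>f'' a\<bar> powr q / (2 powr (q + 2) * (q + 2))
      + incomplete_Beta (1 / 2) (q + 1) 2 * \<bar>f'' b\<bar> powr q) powr (1 / q))"
    by (intro mult_left_mono add_mono b1 b2) simp
  also have "\<dots> = (b - a)\<^sup>2 * ?C * ((\<bar>f'' b\<bar> powr q / (2 powr (q + 2) * (q + 2))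
          + incomplete_Beta (1 / 2) (q + 1) 2 * \<bar>f'' a\<bar> powr q) powr (1 / q)
       + (incomplete_Beta (1 / 2) (q + 1) 2 * \<bar>f'' b\<bar> powr q
          + \<bar>f'' a\<bar> powr q / (2 powr (q + 2) * (q + 2))) powr (1 / q))"
    by (simp only: distrib_left mult.assoc add.commute)
  finally show ?thesis
    unfolding E_def .
qed

end
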